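(* Let $M$ be an $n\times n$ $Q_0$-matrix and let $S$ be the solution mapping of the linear complementarity problem, $$S(q)=\{x\in\mathbb{R}^n\mid x\ge0,\ Mx+q\ge0,\ x^\top(Mx+q)=0\},\qquad q\in\mathbb{R}^n.$$ Let $(\bar q,\bar x)\in\operatorname{gph} S$. Then $S$ has the Lipschitz-like property relative to its domain $\operatorname{dom} S$ at $\bar q$ for $\bar x$ if and only if, for every $u^*\in\mathbb{R}^n$, $$(u^*,-M^*u^* )\in W\big(I_1(\bar q,\bar x),I_2(\bar q,\bar x),I_3(\bar q,\bar x)\big)\ \Longrightarrow\ (u^*,-M^*u^* )\in W'\big(I_1(\bar q,\bar x),I_2(\bar q,\bar x),I_3(\bar q,\bar x)\big).$$
   Context: $M$ is a $Q_0$-matrix if, for each $q\in\mathbb{R}^n$, the problem $x\ge0$, $Mx+q\ge0$, $x^\top(Mx+q)=0$ is solvable whenever it is feasible (i.e. whenever some $x\ge0$ satisfies $Mx+q\ge0$). $M^*$ is the transpose of $M$. $\operatorname{gph} S=\{(q,x)\mid x\in S(q)\}$, $\operatorname{dom} S=\{q\mid S(q)\ne\emptyset\}$. Let $I=\{1,\dots,n\}$, $\mathbb{R}_-=(-\infty,0]$. For $(q,x)\in\operatorname{gph} S$: $I_1(q,x)=\{i\in I\mid x_i=0,(Mx+q)_i>0\}$, $I_2(q,x)=\{i\in I\mid x_i>0,(Mx+q)_i=0\}$, $I_3(q,x)=\{i\in I\mid x_i=0,(Mx+q)_i=0\}$. For a partition $(I_1,I_2,I_3)$ of $I$ (parts may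 be empty) and $\Omega:=(\{0\}\times\mathbb{R})\cup(\mathbb{R}\times\{0\})\cup\mathbb{R}^2_-$: $W(I_1,I_2,I_3)$ is the set of $(u^*,v^* )\in\mathbb{R}^n\times\mathbb{R}^n$ with $(u^*_i,v^*_i)\in\{0\}\times\mathbb{R}$ for $i\in I_1$, $(u^*_i,v^*_i)\in\mathbb{R}\times\{0\}$ for $i\in I_2$, $(u^*_i,v^*_i)\in\Omega$ for $i\in I_3$; $W'(I_1,I_2,I_3)$ is the set of $(u^*,v^* )\in\mathbb{R}^n\times\mathbb{R}^n$ with $(u^*_i,v^*_i)\in\{0\}\times\mathbb{R}_-$ for $i\in I_1$, $(u^*_i,v^*_i)\in\mathbb{R}_-\times\{0\}$ for $i\in I_2$, $(u^*_i,v^*_i)\in\mathbb{R}^2_-$ for $i\in I_3$. $S$ is Lipschitz-like relative to $X$ at $\bar q\in X$ for $\bar x\in S(\bar q)$ if $\operatorname{gph} S$ is locally closed at $(\bar q,\bar x)$ and there are neighborhoods $V$ of $\bar q$, $U$ of $\bar x$ and $\kappa\ge0$ with $S(q')\cap U\subset S(q)+\kappa\|q'-q\|\mathbb{B}$ for all $q,q'\in X\cap V$, where $\mathbb{B}$ is the closed unit ball. *)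

theory Defs
  imports "HOL-Analysis.Analysis"
begin

definition gph :: "('a \<Rightarrow> 'b set) \<Rightarrow> ('a \<times> 'b) set" where
  "gph F = {(q, x). x \<in> F q}"

definition domain_of :: "('a \<Rightarrow> 'b set) \<Rightarrow> 'a set" where
  "domain_of F = {q. F q \<noteq> {}}"

text \<open>Neighbourhoods of \<open>z\<close> are the sets \<open>V\<close> with \<open>z \<in> interior V\<close>; they need not be open.\<close>

definition locally_closed_at :: "'a::topological_space set \<Rightarrow> 'a \<Rightarrow> bool" where
  "locally_closed_at C z \<longleftrightarrow> (\<exists>V. closed V \<and> z \<in> interior V \<and> closed (C \<inter> V))"

definition lipschitz_like_relative ::
  "('a::real_normed_vector \<Rightarrow> 'b::real_normed_vector set) \<Rightarrow> 'a set \<Rightarrow> 'a \<Rightarrow> 'b \<Rightarrow> bool" where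
  "lipschitz_like_relative F X qbar xbar \<longleftrightarrow>
     qbar \<in> X \<and> xbar \<in> F qbar \<and>
     locally_closed_at (gph F) (qbar, xbar) \<and>
     (\<exists>V U. \<exists>\<kappa>\<ge>0. qbar \<in> interior V \<and> xbar \<in> interior U \<and>
        (\<forall>q\<in>X \<inter> V. \<forall>q'\<in>X \<inter> V.
           F q' \<inter> U \<subseteq> {y + (\<kappa> * norm (q' - q)) *\<^sub>R b | y b. y \<in> F q \<and> b \<in> cball 0 1}))"

text \<open>The order on \<open>real ^ 'n\<close> is the componentwise one.\<close>

definition lcp_sol :: "real ^ 'n ^ 'n \<Rightarrow> real ^ 'n \<Rightarrow> (real ^ 'n) set" where
  "lcp_sol M q = {x. 0 \<le> x \<and> 0 \<le> M *v x + q \<and> x \<bullet> (M *v x + q) = 0}"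

definition Q0_matrix :: "real ^ 'n ^ 'n \<Rightarrow> bool" where
  "Q0_matrix M \<longleftrightarrow>
     (\<forall>q. (\<exists>x. 0 \<le> x \<and> 0 \<le> M *v x + q) \<longrightarrow>
          (\<exists>x. 0 \<le> x \<and> 0 \<le> M *v x + q \<and> x \<bullet> (M *v x + q) = 0))"

definition idx1 :: "real ^ 'n ^ 'n \<Rightarrow> real ^ 'n \<Rightarrow> real ^ 'n \<Rightarrow> 'n set" where
  "idx1 M q x = {i. x $ i = 0 \<and> (M *v x + q) $ i > 0}"

definition idx2 :: "real ^ 'n ^ 'n \<Rightarrow> real ^ 'n \<Rightarrow> real ^ 'n \<Rightarrow> 'n set" where
  "idx2 M q x = {i. x $ i > 0 \<and> (M *v x + q) $ i = 0}"

definition idx3 :: "real ^ 'n ^ 'n \<Rightarrow> real ^ 'n \<Rightarrow> real ^ 'n \<Rightarrow> 'n set" where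
  "idx3 M q x = {i. x $ i = 0 \<and> (M *v x + q) $ i = 0}"

definition Omega :: "(real \<times> real) set" where
  "Omega = ({0} \<times> UNIV) \<union> (UNIV \<times> {0}) \<union> ({..0} \<times> {..0})"

definition W_cone :: "'n set \<Rightarrow> 'n set \<Rightarrow> 'n set \<Rightarrow> ((real ^ 'n) \<times> (real ^ 'n)) set" where
  "W_cone I1 I2 I3 = {(u, v).
     (\<forall>i\<in>I1. (u $ i, v $ i) \<in> {0} \<times> UNIV) \<and>
     (\<forall>i\<in>I2. (u $ i, v $ i) \<in> UNIV \<times> {0}) \<and>
     (\<forall>i\<in>I3. (u $ i, v $ i) \<in> Omega)}"

definition W'_cone :: "'n set \<Rightarrow> 'n set \<Rightarrow> 'n set \<Rightarrow> ((real ^ 'n) \<times> (real ^ 'n)) set" where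
  "W'_cone I1 I2 I3 = {(u, v).
     (\<forall>i\<in>I1. (u $ i, v $ i) \<in> {0} \<times> {..0}) \<and>
     (\<forall>i\<in>I2. (u $ i, v $ i) \<in> {..0} \<times> {0}) \<and>
     (\<forall>i\<in>I3. (u $ i, v $ i) \<in> {..0} \<times> {..0})}"

end

theory Submission
  imports Defs
begin

text \<open>
  In the variables \<open>(x, w)\<close> with \<open>w = M x + q\<close> the graph of \<open>S\<close> is the linear image
  \<open>q = w - M x\<close> of a complementarity set that is locally a cone. The elements of \<open>W\<close>
  are the limiting normals \<open>(u, 0)\<close> of the graph, and \<open>W'\<close> describes the normal cone of the convex
  cone \<open>dom S\<close> (convex since \<open>M\<close> is \<open>Q\<^sub>0\<close>).

  Necessity: every such \<open>u\<close> is a regular normal at an arbitrarily close point of the graph; the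
  Lipschitz-like property there forces \<open>u\<close> to be nonpositive on all directions \<open>e\<^sub>i\<close> and
  \<open>- M e\<^sub>i\<close> of \<open>dom S\<close>.

  Sufficiency: if a direction \<open>d\<close> into \<open>dom S\<close> were not attained by the local cone at a nearby
  point, the difference of \<open>d\<close> and its nearest attained direction would be an element of \<open>W\<close> outside
  \<open>W'\<close>. Hence a solution can always be continued along the segment from \<open>q'\<close> to \<open>q\<close>, at a speed
  bounded by a conformal version of Caratheodory's theorem.
\<close>

section \<open>Sign-preserving preimages of bounded size under a linear map\<close>

text \<open>Caratheodory elimination: while the kernel of \<open>f\<close> contains a nonzero
  \<open>h\<close> supported in the support of \<open>z\<close>, a multiple of \<open>h\<close>
  cancels a coordinate of \<open>z\<close> without changing the sign of any other. The support
  shrinks, so the process ends.\<close>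

lemma conformal_support_reduction:
  fixes f :: "'a::euclidean_space \<Rightarrow> 'b::real_vector"
  assumes "linear f"
  shows "\<exists>z'. f z' = f z \<and> (\<forall>b\<in>Basis. z' \<bullet> b = 0 \<or> sgn (z' \<bullet> b) = sgn (z \<bullet> b)) \<and>
    (\<forall>h. (\<forall>b\<in>Basis. z' \<bullet> b = 0 \<longrightarrow> h \<bullet> b = 0) \<and> f h = 0 \<longrightarrow> h = 0)"
proof (induction "card {b\<in>Basis. z \<bullet> b \<noteq> 0}" arbitrary: z rule: less_induct)
  case less
  show ?case
  proof (cases "\<forall>h. (\<forall>b\<in>Basis. z \<bullet> b = 0 \<longrightarrow> h \<bullet> b = 0) \<and> f h = 0 \<longrightarrow> h = 0")
    case True
    then show ?thesis by (intro exI[of _ z]) auto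
  next
    case False
    then obtain h where h: "\<And>b. b \<in> Basis \<Longrightarrow> z \<bullet> b = 0 \<Longrightarrow> h \<bullet> b = 0" "f h = 0" "h \<noteq> 0"
      by blast
    let ?B = "{b\<in>Basis. h \<bullet> b \<noteq> 0}"
    have "finite ?B" "?B \<noteq> {}"
      using h(3) by (auto simp: euclidean_eq_iff[of h])
    then obtain b where b: "b \<in> ?B" and "\<forall>c\<in>?B. \<bar>z \<bullet> b\<bar> / \<bar>h \<bullet> b\<bar> \<le> \<bar>z \<bullet> c\<bar> / \<bar>h \<bullet> c\<bar>"
      using ex_is_arg_min_if_finite[of ?B "\<lambda>c. \<bar>z \<bullet> c\<bar> / \<bar>h \<bullet> c\<bar>"]
      by (auto simp: is_arg_min_linorder)
    then have min: "\<bar>z \<bullet> b\<bar> / \<bar>h \<bullet> b\<bar> * \<bar>h \<bullet> c\<bar> \<le> \<bar>z \<bullet> c\<bar>" if "c \<in> Basis" for c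
      using that by (cases "h \<bullet> c = 0") (auto simp: pos_le_divide_eq)
    \<comment> \<open>This \<open>t\<close> cancels coordinate \<open>b\<close>; by minimality of
      the ratio no coordinate moves by more than its own absolute value.\<close>
    define t where "t = - (z \<bullet> b) / (h \<bullet> b)"
    define z1 where "z1 = z + t *\<^sub>R h"
    have z1: "z1 \<bullet> c = z \<bullet> c + t * (h \<bullet> c)" for c
      by (simp add: z1_def inner_add_left)
    have small: "\<bar>t * (h \<bullet> c)\<bar> \<le> \<bar>z \<bullet> c\<bar>" if "c \<in> Basis" for c
      using min[OF that] by (simp add: t_def abs_mult)
    have sgn1: "z1 \<bullet> c = 0 \<or> sgn (z1 \<bullet> c) = sgn (z \<bullet> c)" if "c \<in> Basis" for c
      using small[OF that] unfolding z1 by (auto simp: sgn_if)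
    have zb: "z1 \<bullet> b = 0" "z \<bullet> b \<noteq> 0" "b \<in> Basis"
      using b h(1) by (auto simp: z1 t_def)
    have "{c\<in>Basis. z1 \<bullet> c \<noteq> 0} \<subset> {c\<in>Basis. z \<bullet> c \<noteq> 0}"
      using zb sgn1 by (force simp: sgn_if split: if_splits)
    then have "card {c\<in>Basis. z1 \<bullet> c \<noteq> 0} < card {c\<in>Basis. z \<bullet> c \<noteq> 0}"
      by (intro psubset_card_mono) auto
    from less[OF this] obtain z' where z': "f z' = f z1"
      "\<forall>b\<in>Basis. z' \<bullet> b = 0 \<or> sgn (z' \<bullet> b) = sgn (z1 \<bullet> b)"
      "\<forall>h. (\<forall>b\<in>Basis. z' \<bullet> b = 0 \<longrightarrow> h \<bullet> b = 0) \<and> f h = 0 \<longrightarrow> h = 0" by blast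
    have "f z1 = f z"
      by (simp add: z1_def h(2) linear_add[OF assms] linear_scale[OF assms])
    moreover have "\<forall>b\<in>Basis. z' \<bullet> b = 0 \<or> sgn (z' \<bullet> b) = sgn (z \<bullet> b)"
      using z'(2) sgn1 by (metis sgn_zero_iff)
    ultimately show ?thesis using z'(1,3) by (intro exI[of _ z']) auto
  qed
qed

text \<open>On a coordinate subspace where \<open>f\<close> is injective it is bounded below, and
  the reduced preimage lies in such a subspace. There are finitely many of them, so the sum of their
  constants serves all.\<close>

lemma conformal_bounded_preimage:
  fixes f :: "'a::euclidean_space \<Rightarrow> 'b::euclidean_space"
  assumes "linear f"
  obtains \<kappa> where "\<kappa> \<ge> 0"
    "\<And>z. \<exists>z'. f z' = f z \<and> (\<forall>b\<in>Basis. z' \<bullet> b = 0 \<or> sgn (z' \<bullet> b) = sgn (z \<bullet> b)) \<and>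
       norm z' \<le> \<kappa> * norm (f z)"
proof -
  let ?S = "\<lambda>T. {h::'a. \<forall>b\<in>T. h \<bullet> b = 0}"
  let ?P = "\<lambda>T K. K \<ge> 0 \<and> ((\<forall>h\<in>?S T. f h = 0 \<longrightarrow> h = 0) \<longrightarrow> (\<forall>h\<in>?S T. norm h \<le> K * norm (f h)))"
  have "\<exists>K. ?P T K" for T
  proof (cases "\<forall>h\<in>?S T. f h = 0 \<longrightarrow> h = 0")
    case True
    have sub: "subspace (?S T)"
      by (auto simp: subspace_def inner_add_left)
    obtain e where e: "e > 0" "\<forall>h\<in>?S T. norm (f h) \<ge> e * norm h"
      using injective_imp_isometric[OF closed_subspace[OF sub] sub _ True] assms
      by (auto simp: linear_conv_bounded_linear)
    then have "\<forall>h\<in>?S T. norm h \<le> inverse e * norm (f h)"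
      by (simp add: field_simps)
    then show ?thesis using e(1) by (intro exI[of _ "inverse e"]) auto
  next
    case False
    \<comment> \<open>Without injectivity no bound is claimed; 0 is a default value.\<close>
    then show ?thesis by (intro exI[of _ 0]) auto
  qed
  then obtain K where K: "\<And>T. ?P T (K T)"
    using choice[of ?P] by blast
  define \<kappa> where "\<kappa> = sum K (Pow (Basis::'a set))"
  show ?thesis
  proof (rule that)
    show "\<kappa> \<ge> 0" unfolding \<kappa>_def using K by (intro sum_nonneg) auto
    fix z
    obtain z' where z': "f z' = f z"
      "\<forall>b\<in>Basis. z' \<bullet> b = 0 \<or> sgn (z' \<bullet> b) = sgn (z \<bullet> b)"
      "\<forall>h. (\<forall>b\<in>Basis. z' \<bullet> b = 0 \<longrightarrow> h \<bullet> b = 0) \<and> f h = 0 \<longrightarrow> h = 0"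
      using conformal_support_reduction[OF assms] by metis
    let ?T = "{b\<in>Basis. z' \<bullet> b = 0}"
    have "norm z' \<le> K ?T * norm (f z')"
      using K[of ?T] z'(3) by auto
    also have "K ?T \<le> \<kappa>"
      unfolding \<kappa>_def using K by (intro member_le_sum) auto
    finally have "norm z' \<le> \<kappa> * norm (f z')"
      by (simp add: mult_right_mono)
    then show "\<exists>z'. f z' = f z \<and> (\<forall>b\<in>Basis. z' \<bullet> b = 0 \<or> sgn (z' \<bullet> b) = sgn (z \<bullet> b)) \<and>
       norm z' \<le> \<kappa> * norm (f z)" using z' by auto
  qed
qed

section \<open>Nearest points, branch cones and their images\<close>

text \<open>The point \<open>k\<close> is also nearest to \<open>d\<close> on a segment inside
  \<open>K\<close>, and the obtuse-angle criterion applies to that convex segment. This handles the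
  possibly nonconvex image of a branch cone.\<close>

lemma inner_le_0_if_nearest:
  fixes d k g :: "'a::euclidean_space"
  assumes "\<delta> > 0" and "\<And>t. 0 \<le> t \<Longrightarrow> t \<le> \<delta> \<Longrightarrow> k + t *\<^sub>R g \<in> K"
    and "\<And>z. z \<in> K \<Longrightarrow> dist d k \<le> dist d z"
  shows "(d - k) \<bullet> g \<le> 0"
proof -
  have "z \<in> K" if "z \<in> closed_segment k (k + \<delta> *\<^sub>R g)" for z
  proof -
    obtain s where s: "0 \<le> s" "s \<le> 1" "z = (1 - s) *\<^sub>R k + s *\<^sub>R (k + \<delta> *\<^sub>R g)"
      using \<open>z \<in> _\<close> by (auto simp: in_segment)
    then have "z = k + (s * \<delta>) *\<^sub>R g" by (simp add: algebra_simps)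
    then show ?thesis using s assms(1) assms(2)[of "s * \<delta>"] by (simp add: mult_left_le_one_le)
  qed
  then have "(d - k) \<bullet> (k + \<delta> *\<^sub>R g - k) \<le> 0"
    using assms(3) by (intro any_closest_point_dot[of "closed_segment k (k + \<delta> *\<^sub>R g)"]) auto
  then show ?thesis using assms(1) by (simp add: mult_le_0_iff)
qed

text \<open>The tangent cone, in the variables \<open>(x, w)\<close>, of the complementarity set at a point with
  \<open>idx1 = J1\<close> and \<open>idx2 = J2\<close>.\<close>

definition branch_cone :: "'n set \<Rightarrow> 'n set \<Rightarrow> ((real ^ 'n) \<times> (real ^ 'n)) set" where
  "branch_cone J1 J2 = {(y, e). \<forall>i.
     (i \<in> J1 \<longrightarrow> y $ i = 0) \<and> (i \<in> J2 \<longrightarrow> e $ i = 0) \<and>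
     (i \<notin> J1 \<longrightarrow> i \<notin> J2 \<longrightarrow> 0 \<le> y $ i \<and> 0 \<le> e $ i \<and> y $ i * e $ i = 0)}"

definition lcp_map :: "real ^ 'n ^ 'n \<Rightarrow> (real ^ 'n) \<times> (real ^ 'n) \<Rightarrow> real ^ 'n" where
  "lcp_map M = (\<lambda>(y, e). e - M *v y)"

lemma linear_lcp_map: "linear (lcp_map M)"
  by (rule linearI)
    (auto simp: lcp_map_def matrix_vector_right_distrib matrix_vector_mult_scaleR algebra_simps)

lemma closed_branch_cone: "closed (branch_cone J1 J2)"
  unfolding branch_cone_def case_prod_beta
  by (intro closed_Collect_all closed_Collect_conj closed_Collect_imp open_Collect_const
      closed_Collect_le closed_Collect_eq continuous_intros)

text \<open>All defining conditions concern only signs of coordinates and survive replacing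
  coordinates by zero.\<close>

lemma branch_cone_conformal:
  assumes "z \<in> branch_cone J1 J2"
    and "\<forall>b\<in>Basis. z' \<bullet> b = 0 \<or> sgn (z' \<bullet> b) = sgn (z \<bullet> b)"
  shows "z' \<in> branch_cone J1 J2"
proof -
  have 1: "fst z' $ i = 0 \<or> sgn (fst z' $ i) = sgn (fst z $ i)" for i
    using assms(2)[rule_format, of "(axis i 1, 0)"]
    by (cases z; cases z') (auto simp: Basis_prod_def axis_in_Basis_iff inner_axis)
  have 2: "snd z' $ i = 0 \<or> sgn (snd z' $ i) = sgn (snd z $ i)" for i
    using assms(2)[rule_format, of "(0, axis i 1)"]
    by (cases z; cases z') (auto simp: Basis_prod_def axis_in_Basis_iff inner_axis)
  show ?thesis
    using assms(1) unfolding branch_cone_def case_prod_beta mem_Collect_eq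
    by (smt (verit) 1 2 sgn_zero_iff sgn_pos sgn_neg mult_eq_0_iff)
qed

text \<open>Since \<open>\<kappa>\<close> is fixed before the index sets, it bounds the speed of
  solution paths at all points of the graph at once.\<close>

lemma branch_cone_bounded_preimage:
  fixes M :: "real ^ 'n ^ 'n"
  obtains \<kappa> where "\<kappa> \<ge> 0"
    "\<And>J1 J2 z. z \<in> branch_cone J1 J2 \<Longrightarrow>
       \<exists>z'\<in>branch_cone J1 J2. lcp_map M z' = lcp_map M z \<and> norm z' \<le> \<kappa> * norm (lcp_map M z)"
proof -
  obtain \<kappa> where \<kappa>: "\<kappa> \<ge> 0"
    "\<And>z. \<exists>z'. lcp_map M z' = lcp_map M z \<and>
       (\<forall>b\<in>Basis. z' \<bullet> b = 0 \<or> sgn (z' \<bullet> b) = sgn (z \<bullet> b)) \<and>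
       norm z' \<le> \<kappa> * norm (lcp_map M z)"
    using conformal_bounded_preimage[OF linear_lcp_map[of M]] by blast
  show ?thesis
  proof (rule that[OF \<kappa>(1)])
    fix J1 J2 and z :: "(real ^ 'n) \<times> (real ^ 'n)"
    assume z: "z \<in> branch_cone J1 J2"
    obtain z' where "lcp_map M z' = lcp_map M z"
      "\<forall>b\<in>Basis. z' \<bullet> b = 0 \<or> sgn (z' \<bullet> b) = sgn (z \<bullet> b)"
      "norm z' \<le> \<kappa> * norm (lcp_map M z)"
      using \<kappa>(2)[of z] by blast
    then show "\<exists>z'\<in>branch_cone J1 J2. lcp_map M z' = lcp_map M z \<and> norm z' \<le> \<kappa> * norm (lcp_map M z)"
      using branch_cone_conformal[OF z] by blast
  qed
qed

text \<open>Preimages of a convergent sequence can be chosen bounded, and a limit point of them maps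
  to the limit. Closedness provides nearest points in the image.\<close>

lemma closed_image_branch_cone:
  fixes M :: "real ^ 'n ^ 'n"
  shows "closed (lcp_map M ` branch_cone J1 J2)"
proof -
  obtain \<kappa> where \<kappa>: "\<kappa> \<ge> 0"
    "\<And>J1 J2 z. z \<in> branch_cone J1 J2 \<Longrightarrow>
       \<exists>z'\<in>branch_cone J1 J2. lcp_map M z' = lcp_map M z \<and> norm z' \<le> \<kappa> * norm (lcp_map M z)"
    using branch_cone_bounded_preimage[of M] by blast
  show ?thesis
    unfolding closed_sequential_limits
  proof (intro allI impI, elim conjE)
    fix X l assume X: "\<forall>n. X n \<in> lcp_map M ` branch_cone J1 J2" and l: "X \<longlonglongrightarrow> l"
    have "\<exists>z\<in>branch_cone J1 J2. lcp_map M z = X n \<and> norm z \<le> \<kappa> * norm (X n)" for n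
      using X[rule_format, of n] \<kappa>(2) by auto
    then obtain Z where Z: "\<And>n. Z n \<in> branch_cone J1 J2" "\<And>n. lcp_map M (Z n) = X n"
      "\<And>n. norm (Z n) \<le> \<kappa> * norm (X n)" by metis
    obtain B where B: "\<And>n. norm (X n) \<le> B"
      using convergent_imp_Bseq[OF convergentI[OF l]] by (auto simp: Bseq_def)
    have "norm (Z n) \<le> \<kappa> * B" for n
      using Z(3)[of n] mult_left_mono[OF B \<kappa>(1), of n] by linarith
    then have "bounded (range Z)" by (auto simp: bounded_iff)
    then obtain z r where r: "strict_mono r" "(Z \<circ> r) \<longlonglongrightarrow> z"
      using bounded_imp_convergent_subsequence by blast
    have "z \<in> branch_cone J1 J2"
      using closed_sequentially[OF closed_branch_cone _ r(2)] Z(1) by auto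
    moreover have "(\<lambda>n. lcp_map M ((Z \<circ> r) n)) \<longlonglongrightarrow> lcp_map M z"
      using bounded_linear.tendsto[OF linear_conv_bounded_linear[THEN iffD1, OF linear_lcp_map] r(2)] .
    then have "(X \<circ> r) \<longlonglongrightarrow> lcp_map M z" by (simp add: Z(2) o_def)
    then have "lcp_map M z = l"
      using LIMSEQ_subseq_LIMSEQ[OF l r(1)] LIMSEQ_unique by blast
    ultimately show "l \<in> lcp_map M ` branch_cone J1 J2" by blast
  qed
qed


section \<open>Local geometry of the solution graph\<close>

text \<open>The adjoint of \<open>lcp_map M\<close> sends \<open>u\<close> to
  \<open>(- (transpose M *v u), u)\<close>, which is how the pair tested in \<open>W_cone\<close>
  arises.\<close>

lemma inner_lcp_map:
  "u \<bullet> lcp_map M (y, e) = u \<bullet> e + (- (transpose M *v u)) \<bullet> y"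
  by (simp add: lcp_map_def inner_diff_right dot_lmul_matrix transpose_matrix_vector)

lemma inner_lcp_map_axis:
  "u \<bullet> lcp_map M (0, axis i 1) = u $ i"
  "u \<bullet> lcp_map M (axis i 1, 0) = (- (transpose M *v u)) $ i"
  by (simp_all only: inner_lcp_map inner_zero_right inner_axis) simp_all

lemma mem_lcp_sol_iff:
  fixes M :: "real ^ 'n ^ 'n"
  shows "x \<in> lcp_sol M q \<longleftrightarrow>
     (\<forall>i. 0 \<le> x $ i \<and> 0 \<le> (M *v x + q) $ i \<and> x $ i * (M *v x + q) $ i = 0)"
proof -
  have "x \<bullet> w = 0 \<longleftrightarrow> (\<forall>i. x $ i * w $ i = 0)"
    if "\<forall>i. 0 \<le> x $ i" "\<forall>i. 0 \<le> w $ i" for w :: "real ^ 'n"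
    unfolding inner_vec_def using that by (subst sum_nonneg_eq_0_iff) auto
  then show ?thesis by (auto simp: lcp_sol_def less_eq_vec_def)
qed

lemma lcp_sol_diff_eq:
  "q' - q = lcp_map M (x' - x, (M *v x' + q') - (M *v x + q))"
  by (simp add: lcp_map_def matrix_vector_mult_diff_distrib)

lemma closed_gph_lcp_sol:
  fixes M :: "real ^ 'n ^ 'n"
  shows "closed (gph (lcp_sol M))"
proof -
  have lin: "continuous_on UNIV (\<lambda>p::(real^'n)\<times>(real^'n). M *v snd p)"
    by (intro bounded_linear.continuous_on[OF matrix_vector_mul_bounded_linear] continuous_intros)
  have "gph (lcp_sol M) = (\<Inter>i. {p. 0 \<le> snd p $ i} \<inter> {p. 0 \<le> (M *v snd p + fst p) $ i} \<inter>
      {p. snd p $ i * (M *v snd p + fst p) $ i = 0})"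
    by (auto simp: gph_def mem_lcp_sol_iff)
  also have "closed \<dots>"
    by (intro closed_INT ballI closed_Int closed_Collect_le closed_Collect_eq continuous_intros lin)
  finally show ?thesis .
qed

text \<open>The strict inequalities in \<open>idx1\<close> and \<open>idx2\<close> are open
  conditions, and complementarity keeps the other factor at zero.\<close>

lemma idx_stable:
  fixes M :: "real ^ 'n ^ 'n"
  obtains r where "r > 0"
    "\<And>q x. dist q qbar < r \<Longrightarrow> dist x xbar < r \<Longrightarrow> x \<in> lcp_sol M q \<Longrightarrow>
       idx1 M qbar xbar \<subseteq> idx1 M q x \<and> idx2 M qbar xbar \<subseteq> idx2 M q x"
proof -
  let ?O = "(\<Inter>i\<in>idx1 M qbar xbar. {p. 0 < (M *v snd p + fst p) $ i}) \<inter>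
    (\<Inter>i\<in>idx2 M qbar xbar. {p. 0 < (snd p :: real^'n) $ i})"
  have lin: "continuous_on UNIV (\<lambda>p::(real^'n)\<times>(real^'n). M *v snd p)"
    by (intro bounded_linear.continuous_on[OF matrix_vector_mul_bounded_linear] continuous_intros)
  have "open ?O"
    by (intro open_Int open_INT finite ballI open_Collect_less continuous_intros lin)
  moreover have "(qbar, xbar) \<in> ?O" by (auto simp: idx1_def idx2_def)
  ultimately obtain A B where AB: "open A" "open B" "qbar \<in> A" "xbar \<in> B" "A \<times> B \<subseteq> ?O"
    by (rule open_prod_elim) auto
  obtain r1 where r1: "r1 > 0" "ball qbar r1 \<subseteq> A"
    using AB(1,3) open_contains_ball by blast
  obtain r2 where r2: "r2 > 0" "ball xbar r2 \<subseteq> B"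
    using AB(2,4) open_contains_ball by blast
  show ?thesis
  proof (rule that[of "min r1 r2"])
    show "min r1 r2 > 0" using r1 r2 by simp
    fix q x assume "dist q qbar < min r1 r2" "dist x xbar < min r1 r2" and x: "x \<in> lcp_sol M q"
    then have "(q, x) \<in> A \<times> B" using r1(2) r2(2) by (auto simp: dist_commute)
    then have "(q, x) \<in> ?O" using AB(5) by blast
    then have "\<forall>i\<in>idx1 M qbar xbar. 0 < (M *v x + q) $ i" "\<forall>i\<in>idx2 M qbar xbar. 0 < x $ i"
      by auto
    moreover have "x $ i = 0 \<or> (M *v x + q) $ i = 0" for i
      using x unfolding mem_lcp_sol_iff mult_eq_0_iff by blast
    ultimately show "idx1 M qbar xbar \<subseteq> idx1 M q x \<and> idx2 M qbar xbar \<subseteq> idx2 M q x"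
      unfolding idx1_def[of M q x] idx2_def[of M q x] by force
  qed
qed

text \<open>For a short time positive entries stay nonnegative, and at a degenerate index at most
  one of the two entries grows. Finitely many indices share a common time.\<close>

lemma lcp_sol_branch_step:
  assumes x: "x \<in> lcp_sol M q"
    and z: "(y, e) \<in> branch_cone (idx1 M q x) (idx2 M q x)"
  shows "\<exists>\<delta>>0. \<forall>t. 0 \<le> t \<and> t \<le> \<delta> \<longrightarrow> x + t *\<^sub>R y \<in> lcp_sol M (q + t *\<^sub>R lcp_map M (y, e))"
proof -
  let ?w = "M *v x + q"
  let ?P = "\<lambda>i t. 0 \<le> x $ i + t * y $ i \<and> 0 \<le> ?w $ i + t * e $ i \<and>
    (x $ i + t * y $ i) * (?w $ i + t * e $ i) = 0"
  \<comment> \<open>A time during which an entry \<open>a\<close> changing at rate \<open>b\<close>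
    stays nonnegative; the added 1 covers \<open>b = 0\<close>.\<close>
  have pos: "0 \<le> a + t * b" if "0 < a" "0 \<le> t" "t \<le> a / (\<bar>b\<bar> + 1)" for a b t :: real
  proof -
    have "t * (\<bar>b\<bar> + 1) \<le> a" using that by (simp add: pos_le_divide_eq)
    moreover have "- (t * b) \<le> t * \<bar>b\<bar>"
      using that(2) by (metis abs_ge_minus_self abs_mult abs_of_nonneg)
    ultimately show ?thesis using that(2) by (simp add: algebra_simps)
  qed
  have "\<exists>\<delta>>0. \<forall>t. 0 \<le> t \<and> t \<le> \<delta> \<longrightarrow> ?P i t" for i
  proof -
    have xi: "0 \<le> x $ i" "0 \<le> ?w $ i" "x $ i = 0 \<or> ?w $ i = 0"
      using x unfolding mem_lcp_sol_iff mult_eq_0_iff by blast+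
    consider "x $ i = 0" "0 < ?w $ i" | "0 < x $ i" "?w $ i = 0" | "x $ i = 0" "?w $ i = 0"
      using xi by linarith
    then show ?thesis
    proof cases
      case 1
      then have "y $ i = 0" using z by (auto simp: branch_cone_def idx1_def)
      with 1 show ?thesis using pos
        by (intro exI[of _ "?w $ i / (\<bar>e $ i\<bar> + 1)"]) auto
    next
      case 2
      then have "e $ i = 0" using z by (auto simp: branch_cone_def idx2_def)
      with 2 show ?thesis using pos
        by (intro exI[of _ "x $ i / (\<bar>y $ i\<bar> + 1)"]) auto
    next
      case 3
      then have "0 \<le> y $ i" "0 \<le> e $ i" "y $ i * e $ i = 0"
        using z by (auto simp: branch_cone_def idx1_def idx2_def)
      with 3 show ?thesis
        by (intro exI[of _ 1]) auto
    qed
  qed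
  then obtain \<delta> where \<delta>: "\<And>i. \<delta> i > 0" "\<And>i t. 0 \<le> t \<Longrightarrow> t \<le> \<delta> i \<Longrightarrow> ?P i t"
    by metis
  have "x + t *\<^sub>R y \<in> lcp_sol M (q + t *\<^sub>R lcp_map M (y, e))"
    if t: "0 \<le> t" "t \<le> Min (range \<delta>)" for t
  proof -
    have "M *v (x + t *\<^sub>R y) + (q + t *\<^sub>R lcp_map M (y, e)) = ?w + t *\<^sub>R e"
      by (simp add: lcp_map_def matrix_vector_right_distrib matrix_vector_mult_scaleR
          scaleR_diff_right)
    moreover have "?P i t" for i using \<delta>(2)[of t i] t by simp
    ultimately show ?thesis
      unfolding mem_lcp_sol_iff by (simp only: vector_add_component vector_scaleR_component) simp
  qed
  then show ?thesis using \<delta>(1) by (intro exI[of _ "Min (range \<delta>)"]) auto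
qed

section \<open>Attaining feasible directions and continuing solutions along a segment\<close>

text \<open>Stationarity of the nearest attained direction \<open>k\<close> under coordinate moves
  puts the residual \<open>u\<close> into \<open>W_cone\<close>. Then \<open>W'_cone\<close> makes
  \<open>u\<close> nonpositive on \<open>?d\<close>, while scaling \<open>k\<close> down shows it
  nonnegative on \<open>k\<close>; hence \<open>u \<bullet> u \<le> 0\<close>. In the application
  \<open>I1, I2, I3\<close> belong to the reference point and \<open>J1, J2\<close> to a nearby
  one.\<close>

lemma feasible_direction_in_branch_image:
  fixes M :: "real ^ 'n ^ 'n"
  assumes cond: "\<And>u. (u, - (transpose M *v u)) \<in> W_cone I1 I2 I3 \<Longrightarrow>
      (u, - (transpose M *v u)) \<in> W'_cone I1 I2 I3"
    and I: "I1 \<subseteq> J1" "I2 \<subseteq> J2" "I1 \<union> I2 \<union> I3 = UNIV" and J: "J1 \<inter> J2 = {}"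
    and a: "\<And>i. i \<notin> J2 \<Longrightarrow> 0 \<le> a $ i" and b: "\<And>i. i \<notin> J1 \<Longrightarrow> 0 \<le> b $ i"
  shows "lcp_map M (a, b) \<in> lcp_map M ` branch_cone J1 J2"
proof -
  let ?C = "branch_cone J1 J2" and ?d = "lcp_map M (a, b)"
  have "0 \<in> ?C" by (simp add: branch_cone_def zero_prod_def)
  then obtain k where k: "k \<in> lcp_map M ` ?C"
    "\<And>z. z \<in> lcp_map M ` ?C \<Longrightarrow> dist ?d k \<le> dist ?d z"
    using distance_attains_inf[OF closed_image_branch_cone[of M J1 J2], of ?d] by blast
  then obtain y e where ye: "(y, e) \<in> ?C" "k = lcp_map M (y, e)" by auto
  define u where "u = ?d - k"
  define v where "v = - (transpose M *v u)"
  have normal: "u \<bullet> lcp_map M h \<le> 0"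
    if "\<delta> > 0" "\<And>t. 0 \<le> t \<Longrightarrow> t \<le> \<delta> \<Longrightarrow> (y, e) + t *\<^sub>R h \<in> ?C" for h \<delta>
    unfolding u_def
  proof (rule inner_le_0_if_nearest[OF that(1) _ k(2)])
    fix t assume "0 \<le> t" "t \<le> \<delta>"
    then have "lcp_map M ((y, e) + t *\<^sub>R h) \<in> lcp_map M ` ?C" using that(2) by blast
    then show "k + t *\<^sub>R lcp_map M h \<in> lcp_map M ` ?C"
      by (simp add: linear_add[OF linear_lcp_map] linear_scale[OF linear_lcp_map] ye(2))
  qed
  have C: "0 \<le> y $ i" "0 \<le> e $ i" "y $ i = 0 \<or> e $ i = 0" if "i \<notin> J1" "i \<notin> J2" for i
    using ye(1) that by (simp_all add: branch_cone_def)
  have neg: "lcp_map M (- h) = - lcp_map M h" for h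
    by (rule linear_neg[OF linear_lcp_map])
  have u_le: "u $ i \<le> 0" if "i \<notin> J2" "i \<in> J1 \<or> y $ i = 0" for i
  proof -
    have "u \<bullet> lcp_map M (0, axis i 1) \<le> 0"
      by (rule normal[of 1]) (use ye(1) that in \<open>auto simp: branch_cone_def axis_def\<close>)
    then show ?thesis by (simp add: inner_lcp_map_axis)
  qed
  have u_ge: "u $ i \<ge> 0" if "i \<notin> J2" "i \<in> J1 \<or> e $ i > 0" for i
  proof -
    \<comment> \<open>For \<open>i \<in> J1\<close> the entry \<open>e $ i\<close> is free;
      otherwise it can decrease up to time \<open>e $ i\<close>, with \<open>y $ i = 0\<close>
      throughout.\<close>
    have "u \<bullet> lcp_map M (- (0, axis i 1)) \<le> 0"
      by (rule normal[of "if i \<in> J1 then 1 else e $ i"])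
        (use ye(1) that in \<open>force simp: branch_cone_def axis_def split: if_splits\<close>)+
    then show ?thesis unfolding neg inner_minus_right inner_lcp_map_axis by simp
  qed
  have v_le: "v $ i \<le> 0" if "i \<notin> J1" "i \<in> J2 \<or> e $ i = 0" for i
  proof -
    have "u \<bullet> lcp_map M (axis i 1, 0) \<le> 0"
      by (rule normal[of 1]) (use ye(1) that in \<open>auto simp: branch_cone_def axis_def\<close>)
    then show ?thesis by (simp add: inner_lcp_map_axis v_def)
  qed
  have v_ge: "v $ i \<ge> 0" if "i \<notin> J1" "i \<in> J2 \<or> y $ i > 0" for i
  proof -
    have "u \<bullet> lcp_map M (- (axis i 1, 0)) \<le> 0"
      by (rule normal[of "if i \<in> J2 then 1 else y $ i"])
        (use ye(1) that in \<open>force simp: branch_cone_def axis_def split: if_splits\<close>)+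
    then show ?thesis unfolding neg inner_minus_right inner_lcp_map_axis v_def by simp
  qed
  have uJ1: "u $ i = 0" if "i \<in> J1" for i
    using u_le[of i] u_ge[of i] J that by fastforce
  have vJ2: "v $ i = 0" if "i \<in> J2" for i
    using v_le[of i] v_ge[of i] J that by fastforce
  \<comment> \<open>Off \<open>J1\<close> and \<open>J2\<close>, \<open>e $ i > 0\<close> forces
    \<open>u $ i = 0\<close>, \<open>y $ i > 0\<close> forces \<open>v $ i = 0\<close>, and if both
    entries vanish then \<open>u $ i\<close> and \<open>v $ i\<close> are nonpositive: the three
    pieces of \<open>Omega\<close>.\<close>
  have "(u $ i, v $ i) \<in> Omega" for i
  proof (cases "i \<in> J1 \<or> i \<in> J2")
    case True
    then show ?thesis using uJ1 vJ2 by (auto simp: Omega_def)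
  next
    case False
    then show ?thesis
      using C[of i] u_le[of i] u_ge[of i] v_le[of i] v_ge[of i] by (force simp: Omega_def)
  qed
  then have "(u, v) \<in> W_cone I1 I2 I3"
    using uJ1 vJ2 I by (auto simp: W_cone_def)
  then have W': "(u, v) \<in> W'_cone I1 I2 I3" using cond v_def by simp
  have le: "u $ i \<le> 0" "v $ i \<le> 0" for i
  proof -
    have "i \<in> I1 \<union> I2 \<union> I3" using I(3) by simp
    then show "u $ i \<le> 0" "v $ i \<le> 0" using W' by (auto simp: W'_cone_def)
  qed
  \<comment> \<open>\<open>b $ i\<close> can be negative only for \<open>i \<in> J1\<close>, where
    \<open>u $ i = 0\<close>; likewise below for \<open>a\<close>, \<open>J2\<close> and
    \<open>v\<close>.\<close>
  have "u $ i * b $ i \<le> 0" for i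
    using uJ1[of i] le(1)[of i] b[of i] by (cases "i \<in> J1") (auto intro: mult_nonpos_nonneg)
  then have "u \<bullet> b \<le> 0" unfolding inner_vec_def by (simp add: sum_nonpos)
  moreover have "v $ i * a $ i \<le> 0" for i
    using vJ2[of i] le(2)[of i] a[of i] by (cases "i \<in> J2") (auto intro: mult_nonpos_nonneg)
  then have "v \<bullet> a \<le> 0" unfolding inner_vec_def by (simp add: sum_nonpos)
  ultimately have "u \<bullet> ?d \<le> 0" unfolding inner_lcp_map v_def[symmetric] by simp
  \<comment> \<open>Shrinking \<open>(y, e)\<close> towards 0 stays in the cone.\<close>
  moreover have "u \<bullet> lcp_map M (- (y, e)) \<le> 0"
  proof (rule normal[of 1])
    fix t :: real assume t: "0 \<le> t" "t \<le> 1"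
    have "(y, e) + t *\<^sub>R - (y, e) = ((1 - t) *\<^sub>R y, (1 - t) *\<^sub>R e)"
      by (simp add: algebra_simps)
    then show "(y, e) + t *\<^sub>R - (y, e) \<in> ?C" using ye(1) t by (auto simp: branch_cone_def)
  qed simp
  then have "0 \<le> u \<bullet> k" unfolding neg ye(2) by simp
  ultimately have "u \<bullet> u \<le> 0" unfolding u_def[symmetric] by (simp add: u_def inner_diff_right)
  then have "u = 0" by (metis inner_gt_zero_iff not_le)
  then show ?thesis using k(1) by (simp add: u_def)
qed

text \<open>Continuous induction: the parameters reachable at speed \<open>L\<close> form a compact
  set, and a largest one below 1 could be extended by \<open>step\<close>.\<close>

lemma segment_continuation:
  fixes F :: "'a::real_normed_vector \<Rightarrow> 'b::euclidean_space set"
  assumes cl: "closed (gph F)" and x0: "x0 \<in> F a" and L: "L \<ge> 0"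
    and step: "\<And>s x. 0 \<le> s \<Longrightarrow> s < 1 \<Longrightarrow> x \<in> F (a + s *\<^sub>R d) \<Longrightarrow> norm (x - x0) \<le> s * L \<Longrightarrow>
      \<exists>s'>s. s' \<le> 1 \<and> (\<exists>x'\<in>F (a + s' *\<^sub>R d). norm (x' - x) \<le> (s' - s) * L)"
  shows "\<exists>x\<in>F (a + d). norm (x - x0) \<le> L"
proof -
  define A where "A = ({0..1::real} \<times> cball x0 L) \<inter>
    (((\<lambda>p. (a + fst p *\<^sub>R d, snd p)) -` gph F) \<inter> {p. norm (snd p - x0) \<le> fst p * L})"
  have memA: "(s, x) \<in> A \<longleftrightarrow> 0 \<le> s \<and> s \<le> 1 \<and> x \<in> F (a + s *\<^sub>R d) \<and> norm (x - x0) \<le> s * L" for s x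
  proof -
    have "norm (x - x0) \<le> L" if "s \<le> 1" "norm (x - x0) \<le> s * L"
      using that mult_right_mono[OF that(1) L] by linarith
    then show ?thesis by (auto simp: A_def gph_def dist_norm norm_minus_commute)
  qed
  have "compact A" unfolding A_def
    by (intro compact_Int_closed compact_Times compact_cball compact_Icc closed_Int
        closed_vimage closed_Collect_le cl continuous_intros)
  then have "compact (fst ` A)"
    by (intro compact_continuous_image continuous_intros)
  moreover have "(0, x0) \<in> A" using x0 by (simp add: memA)
  ultimately obtain s where s: "s \<in> fst ` A" "\<forall>s'\<in>fst ` A. s' \<le> s"
    using compact_attains_sup[of "fst ` A"] by blast
  then obtain x where x: "(s, x) \<in> A" by auto
  have "s = 1"
  proof (rule ccontr)
    assume "s \<noteq> 1"
    then obtain s' x' where s': "s' > s" "s' \<le> 1" "x' \<in> F (a + s' *\<^sub>R d)"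
      "norm (x' - x) \<le> (s' - s) * L"
      using step[of s x] x unfolding memA by force
    have "norm (x' - x0) \<le> norm (x' - x) + norm (x - x0)"
      using norm_triangle_ineq[of "x' - x" "x - x0"] by simp
    then have "(s', x') \<in> A" using s' x unfolding memA by (auto simp: algebra_simps)
    then have "s' \<in> fst ` A" by force
    then show False using s(2) s'(1) by force
  qed
  then show ?thesis using x unfolding memA by auto
qed

section \<open>Necessity: normals at nearby points of the graph\<close>

text \<open>By the adjoint formula \<open>u \<bullet> (q - q0)\<close> is a sum over indices. Where
  one multiplier is zero, index stability makes the increment facing the other one vanish; at
  degenerate indices the signs are opposite. No remainder term occurs because the graph is locally
  conical.\<close>

lemma regular_normal_inequality:
  fixes M :: "real ^ 'n ^ 'n"
  defines "v \<equiv> \<lambda>u. - (transpose M *v u)"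
  assumes x: "x \<in> lcp_sol M q"
    and x0: "idx1 M q0 x0 \<subseteq> idx1 M q x" "idx2 M q0 x0 \<subseteq> idx2 M q x"
    and normal: "\<And>i. i \<in> idx1 M q0 x0 \<and> u $ i = 0 \<or> i \<in> idx2 M q0 x0 \<and> v u $ i = 0 \<or>
        i \<in> idx3 M q0 x0 \<and> u $ i \<le> 0 \<and> v u $ i \<le> 0"
  shows "u \<bullet> (q - q0) \<le> 0"
proof -
  let ?e = "(M *v x + q) - (M *v x0 + q0)" and ?y = "x - x0"
  have "u $ i * ?e $ i + v u $ i * ?y $ i \<le> 0" for i
  proof -
    have pos: "0 \<le> x $ i" "0 \<le> (M *v x + q) $ i"
      using x by (auto simp: mem_lcp_sol_iff)
    consider "i \<in> idx1 M q0 x0" "u $ i = 0" | "i \<in> idx2 M q0 x0" "v u $ i = 0"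
      | "i \<in> idx3 M q0 x0" "u $ i \<le> 0" "v u $ i \<le> 0"
      using normal by blast
    then show ?thesis
    proof cases
      case 1
      then have "?y $ i = 0" using x0(1) by (auto simp: idx1_def)
      with 1 show ?thesis by simp
    next
      case 2
      then have "?e $ i = 0" using x0(2) by (auto simp: idx2_def)
      with 2 show ?thesis by simp
    next
      case 3
      then have "?e $ i = (M *v x + q) $ i" "?y $ i = x $ i" by (auto simp: idx3_def)
      then show ?thesis
        using 3 pos by (metis add_nonpos_nonpos mult_nonpos_nonneg)
    qed
  qed
  then have "u \<bullet> ?e + v u \<bullet> ?y \<le> 0"
    unfolding inner_vec_def sum.distrib[symmetric] by (auto intro!: sum_nonpos)
  then show ?thesis
    by (simp add: lcp_sol_diff_eq[of q q0 M x x0] inner_lcp_map v_def)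
qed

text \<open>Here the \<open>Q0_matrix\<close> property turns the domain into a linear image of the
  nonnegative orthant, so adding nonnegative directions does not leave it.\<close>

lemma domain_of_lcp_sol_iff:
  assumes "Q0_matrix M"
  shows "q \<in> domain_of (lcp_sol M) \<longleftrightarrow> (\<exists>x w. 0 \<le> x \<and> 0 \<le> w \<and> q = lcp_map M (x, w))"
proof
  assume "q \<in> domain_of (lcp_sol M)"
  then obtain x where "0 \<le> x" "0 \<le> M *v x + q"
    by (auto simp: domain_of_def lcp_sol_def)
  then show "\<exists>x w. 0 \<le> x \<and> 0 \<le> w \<and> q = lcp_map M (x, w)"
    by (intro exI[of _ x] exI[of _ "M *v x + q"]) (simp add: lcp_map_def)
next
  assume "\<exists>x w. 0 \<le> x \<and> 0 \<le> w \<and> q = lcp_map M (x, w)"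
  then have "\<exists>x. 0 \<le> x \<and> 0 \<le> M *v x + q" by (auto simp: lcp_map_def)
  then show "q \<in> domain_of (lcp_sol M)"
    using assms by (auto simp: Q0_matrix_def domain_of_def lcp_sol_def)
qed

lemma small_multiple:
  fixes h :: "'a::real_normed_vector"
  assumes "r > 0"
  obtains t :: real where "t > 0" "t * norm h < r"
proof (rule that[of "r / (norm h + 1)"])
  show "r / (norm h + 1) > 0" using assms by (simp add: add_nonneg_pos)
  show "r / (norm h + 1) * norm h < r"
    using assms by (simp add: divide_less_eq add_nonneg_pos)
qed

text \<open>After a small move along \<open>?d\<close> the Lipschitz property supplies a solution so
  close to \<open>x0\<close> that the index sets are stable and the normal inequality applies. The
  base point is kept separate from the reference point because it will be a perturbation of
  it.\<close>

lemma lipschitz_like_imp_directional: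
  fixes M :: "real ^ 'n ^ 'n"
  assumes Q0: "Q0_matrix M" and x0: "x0 \<in> lcp_sol M q0"
    and VU: "q0 \<in> interior V" "x0 \<in> U" and \<kappa>: "\<kappa> \<ge> 0"
    and lip: "\<And>q q'. q \<in> domain_of (lcp_sol M) \<inter> V \<Longrightarrow> q' \<in> domain_of (lcp_sol M) \<inter> V \<Longrightarrow>
       lcp_sol M q' \<inter> U \<subseteq> {y + (\<kappa> * norm (q' - q)) *\<^sub>R b | y b. y \<in> lcp_sol M q \<and> b \<in> cball 0 1}"
    and normal: "\<And>i. i \<in> idx1 M q0 x0 \<and> u $ i = 0 \<or>
        i \<in> idx2 M q0 x0 \<and> (- (transpose M *v u)) $ i = 0 \<or>
        i \<in> idx3 M q0 x0 \<and> u $ i \<le> 0 \<and> (- (transpose M *v u)) $ i \<le> 0"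
    and ab: "0 \<le> a" "0 \<le> b"
  shows "u \<bullet> lcp_map M (a, b) \<le> 0"
proof -
  let ?d = "lcp_map M (a, b)" and ?D = "domain_of (lcp_sol M)"
  obtain r where r: "r > 0" "\<And>q x. dist q q0 < r \<Longrightarrow> dist x x0 < r \<Longrightarrow> x \<in> lcp_sol M q \<Longrightarrow>
       idx1 M q0 x0 \<subseteq> idx1 M q x \<and> idx2 M q0 x0 \<subseteq> idx2 M q x"
    using idx_stable[of q0 x0 M] by blast
  obtain \<rho> where \<rho>: "\<rho> > 0" "ball q0 \<rho> \<subseteq> V"
    using VU(1) by (auto simp: mem_interior)
  \<comment> \<open>The factor \<open>1 + \<kappa>\<close> covers the displacement of the parameter
    and that of the solution, at most \<open>\<kappa>\<close> times as large.\<close>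
  obtain s where s: "s > 0" "s * norm ((1 + \<kappa>) *\<^sub>R ?d) < min r \<rho>"
    using small_multiple[of "min r \<rho>" "(1 + \<kappa>) *\<^sub>R ?d"] r(1) \<rho>(1) by auto
  have "0 \<le> s * norm ?d" "0 \<le> \<kappa> * (s * norm ?d)" using s(1) \<kappa> by auto
  moreover have "s * norm ?d + \<kappa> * (s * norm ?d) < min r \<rho>"
  proof -
    have "s * norm ((1 + \<kappa>) *\<^sub>R ?d) = s * norm ?d + \<kappa> * (s * norm ?d)"
      unfolding norm_scaleR using \<kappa> by (simp only: abs_of_nonneg add_nonneg_nonneg zero_le_one) (simp add: algebra_simps)
    then show ?thesis using s(2) by simp
  qed
  ultimately have sd: "s * norm ?d < r" "s * norm ?d < \<rho>" "\<kappa> * (s * norm ?d) < r" by auto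
  define q where "q = q0 + s *\<^sub>R ?d"
  have q0: "q0 = lcp_map M (x0, M *v x0 + q0)" by (simp add: lcp_map_def)
  have x0_ge: "0 \<le> x0" "0 \<le> M *v x0 + q0" using x0 by (auto simp: lcp_sol_def)
  have "q = lcp_map M ((x0, M *v x0 + q0) + s *\<^sub>R (a, b))"
    unfolding linear_add[OF linear_lcp_map] linear_scale[OF linear_lcp_map] q_def
    using q0 by simp
  then have "q = lcp_map M (x0 + s *\<^sub>R a, (M *v x0 + q0) + s *\<^sub>R b)" by simp
  moreover have "0 \<le> x0 + s *\<^sub>R a" "0 \<le> (M *v x0 + q0) + s *\<^sub>R b"
    using x0_ge ab s(1) by (auto simp: less_eq_vec_def)
  ultimately have "q \<in> ?D" unfolding domain_of_lcp_sol_iff[OF Q0] by blast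
  moreover have dq: "norm (q - q0) = s * norm ?d" using s(1) by (simp add: q_def)
  then have "q \<in> V" using \<rho>(2) sd(2) by (auto simp: dist_norm norm_minus_commute)
  moreover have "q0 \<in> ?D" "q0 \<in> V"
    using x0 VU(1) interior_subset by (auto simp: domain_of_def)
  ultimately have "x0 \<in> {y + (\<kappa> * norm (q0 - q)) *\<^sub>R b | y b. y \<in> lcp_sol M q \<and> b \<in> cball 0 1}"
    using lip[of q q0] x0 VU(2) by blast
  then obtain x c where x: "x \<in> lcp_sol M q" "x0 = x + (\<kappa> * norm (q0 - q)) *\<^sub>R c" "norm c \<le> 1"
    by auto
  have "dist x x0 = \<kappa> * norm (q - q0) * norm c"
    using \<kappa> by (simp add: x(2) dist_norm norm_minus_commute)
  also have "\<dots> \<le> \<kappa> * norm (q - q0)"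
    using x(3) \<kappa> by (simp add: mult_left_le)
  finally have "dist x x0 < r" using sd(3) dq by simp
  then have "u \<bullet> (q - q0) \<le> 0"
    using r(2)[of q x] x(1) sd(1) dq normal
    by (intro regular_normal_inequality[of x M q q0 x0 u]) (auto simp: dist_norm)
  then show ?thesis using s(1) by (simp add: q_def mult_le_0_iff)
qed

text \<open>\<open>W'_cone\<close> is the part of \<open>W_cone\<close> with all entries of
  \<open>u\<close> and \<open>v\<close> nonpositive; these signs follow by testing on the axis
  directions.\<close>

lemma lipschitz_like_imp_W'_cone:
  fixes M :: "real ^ 'n ^ 'n"
  assumes Q0: "Q0_matrix M" and xbar: "xbar \<in> lcp_sol M qbar"
    and lip: "lipschitz_like_relative (lcp_sol M) (domain_of (lcp_sol M)) qbar xbar"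
    and W: "(u, - (transpose M *v u)) \<in> W_cone (idx1 M qbar xbar) (idx2 M qbar xbar) (idx3 M qbar xbar)"
  shows "(u, - (transpose M *v u)) \<in> W'_cone (idx1 M qbar xbar) (idx2 M qbar xbar) (idx3 M qbar xbar)"
proof -
  define v where "v = - (transpose M *v u)"
  let ?D = "domain_of (lcp_sol M)"
  obtain V U \<kappa> where \<kappa>: "\<kappa> \<ge> 0" and int: "qbar \<in> interior V" "xbar \<in> interior U"
    and VU: "\<forall>q\<in>?D \<inter> V. \<forall>q'\<in>?D \<inter> V. lcp_sol M q' \<inter> U \<subseteq>
      {y + (\<kappa> * norm (q' - q)) *\<^sub>R b | y b. y \<in> lcp_sol M q \<and> b \<in> cball 0 1}"
    using lip unfolding lipschitz_like_relative_def by blast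
  obtain r1 where r1: "r1 > 0" "ball qbar r1 \<subseteq> interior V"
    using int(1) open_contains_ball open_interior by blast
  obtain r2 where r2: "r2 > 0" "ball xbar r2 \<subseteq> U"
    using int(2) by (auto simp: mem_interior)
  let ?w = "M *v xbar + qbar"
  text \<open>Degenerate indices at which \<open>u\<close> or \<open>v\<close> is positive are pushed into
    \<open>idx2\<close> or \<open>idx1\<close>; at the perturbed point \<open>(u, 0)\<close> is a regular normal to the graph.\<close>
  define h :: "real ^ 'n" where "h = (\<chi> i. if i \<in> idx3 M qbar xbar \<and> u $ i > 0 then 1 else 0)"
  define g :: "real ^ 'n" where "g = (\<chi> i. if i \<in> idx3 M qbar xbar \<and> v $ i > 0 then 1 else 0)"
  obtain t where t: "t > 0" "t * norm (h, lcp_map M (h, g)) < min r1 r2"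
    using small_multiple[of "min r1 r2" "(h, lcp_map M (h, g))"] r1(1) r2(1) by auto
  define x0 where "x0 = xbar + t *\<^sub>R h"
  define q0 where "q0 = qbar + t *\<^sub>R lcp_map M (h, g)"
  have w0: "M *v x0 + q0 = ?w + t *\<^sub>R g"
    by (simp add: x0_def q0_def lcp_map_def matrix_vector_right_distrib
        matrix_vector_mult_scaleR scaleR_diff_right)
  have "t * norm h < min r1 r2" "t * norm (lcp_map M (h, g)) < min r1 r2"
    using t mult_left_mono[OF norm_fst_le[of h "lcp_map M (h, g)"], of t]
      mult_left_mono[OF norm_snd_le[of "lcp_map M (h, g)" h], of t] by linarith+
  then have "q0 \<in> ball qbar r1" "x0 \<in> ball xbar r2"
    using t(1) by (auto simp: x0_def q0_def dist_norm)
  then have q0V: "q0 \<in> interior V" and x0U: "x0 \<in> U" using r1(2) r2(2) by auto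
  have comp: "x0 \<in> lcp_sol M q0 \<and>
      (i \<in> idx1 M q0 x0 \<and> u $ i = 0 \<or> i \<in> idx2 M q0 x0 \<and> v $ i = 0 \<or>
       i \<in> idx3 M q0 x0 \<and> u $ i \<le> 0 \<and> v $ i \<le> 0)" for i
  proof -
    have *: "(0 \<le> x0 $ j \<and> 0 \<le> (M *v x0 + q0) $ j \<and> x0 $ j * (M *v x0 + q0) $ j = 0) \<and>
      (j \<in> idx1 M q0 x0 \<and> u $ j = 0 \<or> j \<in> idx2 M q0 x0 \<and> v $ j = 0 \<or>
       j \<in> idx3 M q0 x0 \<and> u $ j \<le> 0 \<and> v $ j \<le> 0)" for j
    proof -
      have bar: "0 \<le> xbar $ j" "0 \<le> ?w $ j" "xbar $ j = 0 \<or> ?w $ j = 0"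
        using xbar unfolding mem_lcp_sol_iff mult_eq_0_iff by blast+
      have x0j: "x0 $ j = xbar $ j + (if j \<in> idx3 M qbar xbar \<and> u $ j > 0 then t else 0)"
        by (simp add: x0_def h_def)
      have w0j: "(M *v x0 + q0) $ j = ?w $ j + (if j \<in> idx3 M qbar xbar \<and> v $ j > 0 then t else 0)"
        unfolding w0 by (simp add: g_def)
      consider "j \<in> idx1 M qbar xbar" | "j \<in> idx2 M qbar xbar" | "j \<in> idx3 M qbar xbar"
        using bar by (force simp: idx1_def idx2_def idx3_def)
      then show ?thesis
      proof cases
        case 1
        then have "u $ j = 0" "xbar $ j = 0" "?w $ j > 0" "j \<notin> idx3 M qbar xbar"
          using W by (auto simp: W_cone_def idx1_def idx3_def)
        then show ?thesis
          unfolding idx1_def idx2_def idx3_def mem_Collect_eq x0j w0j by simp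
      next
        case 2
        then have "v $ j = 0" "xbar $ j > 0" "?w $ j = 0" "j \<notin> idx3 M qbar xbar"
          using W by (auto simp: W_cone_def idx2_def idx3_def v_def)
        then show ?thesis
          unfolding idx1_def idx2_def idx3_def mem_Collect_eq x0j w0j by simp
      next
        \<comment> \<open>In \<open>Omega\<close>, \<open>u $ j > 0\<close> forces
          \<open>v $ j = 0\<close> and \<open>v $ j > 0\<close> forces \<open>u $ j = 0\<close>, so
          at most one entry is raised and complementarity survives.\<close>
        case 3
        then have "xbar $ j = 0" "?w $ j = 0" "(u $ j, v $ j) \<in> Omega"
          using W by (auto simp: W_cone_def idx3_def v_def)
        then show ?thesis using 3 t(1)
          unfolding idx1_def[of M q0] idx2_def[of M q0] idx3_def[of M q0] mem_Collect_eq x0j w0j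
          by (auto simp: Omega_def)
      qed
    qed
    then show ?thesis unfolding mem_lcp_sol_iff by blast
  qed
  have dir: "u \<bullet> lcp_map M (a, b) \<le> 0" if "0 \<le> a" "0 \<le> b" for a b
    by (rule lipschitz_like_imp_directional[OF Q0 _ q0V x0U \<kappa>])
      (use comp VU that in \<open>auto simp: v_def\<close>)
  have ax: "0 \<le> axis i (1::real)" for i :: 'n by (auto simp: less_eq_vec_def axis_def)
  have "u $ i \<le> 0" "v $ i \<le> 0" for i
    using dir[of 0 "axis i 1"] dir[of "axis i 1" 0] ax
    unfolding inner_lcp_map_axis v_def by auto
  then show ?thesis
    using W unfolding W_cone_def W'_cone_def v_def[symmetric] by auto
qed

section \<open>Sufficiency: solution paths of bounded speed\<close>

text \<open>Solutions are given at the two ends of the segment; the continuation produces those in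
  between. At each point reached, the direction to \<open>q\<close> comes from a difference of two
  solutions, hence is attained by the local branch cone at cost \<open>\<kappa>\<close>.\<close>

lemma W_cone_condition_imp_lipschitz_like:
  fixes M :: "real ^ 'n ^ 'n"
  assumes xbar: "xbar \<in> lcp_sol M qbar"
    and cond: "\<And>u. (u, - (transpose M *v u)) \<in> W_cone (idx1 M qbar xbar) (idx2 M qbar xbar) (idx3 M qbar xbar) \<Longrightarrow>
      (u, - (transpose M *v u)) \<in> W'_cone (idx1 M qbar xbar) (idx2 M qbar xbar) (idx3 M qbar xbar)"
  shows "lipschitz_like_relative (lcp_sol M) (domain_of (lcp_sol M)) qbar xbar"
proof -
  let ?D = "domain_of (lcp_sol M)"
  obtain \<kappa> where \<kappa>: "\<kappa> \<ge> 0"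
    "\<And>J1 J2 z. z \<in> branch_cone J1 J2 \<Longrightarrow>
       \<exists>z'\<in>branch_cone J1 J2. lcp_map M z' = lcp_map M z \<and> norm z' \<le> \<kappa> * norm (lcp_map M z)"
    using branch_cone_bounded_preimage[of M] by blast
  obtain r where r: "r > 0"
    "\<And>q x. dist q qbar < r \<Longrightarrow> dist x xbar < r \<Longrightarrow> x \<in> lcp_sol M q \<Longrightarrow>
       idx1 M qbar xbar \<subseteq> idx1 M q x \<and> idx2 M qbar xbar \<subseteq> idx2 M q x"
    using idx_stable[of qbar xbar M] by blast
  have cover: "idx1 M qbar xbar \<union> idx2 M qbar xbar \<union> idx3 M qbar xbar = UNIV"
    using xbar unfolding mem_lcp_sol_iff mult_eq_0_iff
    by (force simp: idx1_def idx2_def idx3_def)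
  \<comment> \<open>A path starting within \<open>\<eta>\<close> of \<open>xbar\<close> moves at
    most \<open>\<kappa>\<close> times the parameter distance, which is bounded by
    \<open>2 * \<eta>\<close>, and so stays within \<open>r\<close>.\<close>
  define \<eta> where "\<eta> = r / (1 + 2 * \<kappa>)"
  have \<eta>: "\<eta> > 0" "\<eta> + 2 * \<kappa> * \<eta> = r" "\<eta> \<le> r"
  proof -
    show "\<eta> > 0" unfolding \<eta>_def using r(1) \<kappa>(1) by (intro divide_pos_pos) auto
    have "\<eta> * (1 + 2 * \<kappa>) = r" unfolding \<eta>_def using \<kappa>(1) by simp
    then show "\<eta> + 2 * \<kappa> * \<eta> = r" by (simp add: algebra_simps)
    moreover have "0 \<le> 2 * \<kappa> * \<eta>" using \<open>\<eta> > 0\<close> \<kappa>(1) by simp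
    ultimately show "\<eta> \<le> r" by linarith
  qed
  have main: "\<exists>x\<in>lcp_sol M q. norm (x - x') \<le> \<kappa> * norm (q - q')"
    if q: "q \<in> ?D" "q \<in> ball qbar \<eta>" and q': "q' \<in> ball qbar \<eta>"
      and x': "x' \<in> lcp_sol M q'" "x' \<in> ball xbar \<eta>" for q q' x'
  proof -
    obtain x2 where x2: "x2 \<in> lcp_sol M q" using q(1) by (auto simp: domain_of_def)
    have dd: "norm (q - q') \<le> 2 * \<eta>"
      using dist_triangle_less_add[of q qbar \<eta> q' \<eta>] q(2) q'
      by (simp add: dist_norm norm_minus_commute)
    have "\<exists>x\<in>lcp_sol M (q' + (q - q')). norm (x - x') \<le> \<kappa> * norm (q - q')"
    proof (rule segment_continuation[OF closed_gph_lcp_sol x'(1)])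
      show "0 \<le> \<kappa> * norm (q - q')" using \<kappa>(1) by simp
      fix s x assume s: "0 \<le> s" "s < 1" and x: "x \<in> lcp_sol M (q' + s *\<^sub>R (q - q'))"
        and xs: "norm (x - x') \<le> s * (\<kappa> * norm (q - q'))"
      define p where "p = q' + s *\<^sub>R (q - q')"
      have qp: "q - p = (1 - s) *\<^sub>R (q - q')" by (simp add: p_def algebra_simps)
      have "p = (1 - s) *\<^sub>R q' + s *\<^sub>R q" by (simp add: p_def algebra_simps)
      then have "p \<in> ball qbar \<eta>"
        using s q(2) q' convexD[OF convex_ball, of q' qbar \<eta> q "1 - s" s] by simp
      then have pr: "dist p qbar < r" using \<eta>(3) by (simp add: dist_commute)
      have "s * (\<kappa> * norm (q - q')) \<le> \<kappa> * norm (q - q')"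
        using s \<kappa>(1) by (simp add: mult_left_le_one_le)
      also have "\<dots> \<le> 2 * \<kappa> * \<eta>" using mult_left_mono[OF dd \<kappa>(1)] by simp
      finally have "dist x xbar < r"
        using xs x'(2) \<eta>(2) dist_triangle[of x xbar x'] by (simp add: dist_norm norm_minus_commute)
      with pr x have idx: "idx1 M qbar xbar \<subseteq> idx1 M p x" "idx2 M qbar xbar \<subseteq> idx2 M p x"
        using r(2) p_def by auto
      have xp: "x \<in> lcp_sol M p" using x p_def by simp
      let ?C = "branch_cone (idx1 M p x) (idx2 M p x)"
      \<comment> \<open>Where \<open>x\<close> vanishes, \<open>x2 - x\<close> is nonnegative, even
        if \<open>x2\<close> is far from \<open>xbar\<close>; the slacks behave alike.\<close>
      have zero: "x $ i = 0" if "i \<notin> idx2 M p x" for i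
        using xp that unfolding mem_lcp_sol_iff mult_eq_0_iff idx2_def by force
      have zero': "(M *v x + p) $ i = 0" if "i \<notin> idx1 M p x" for i
        using xp that unfolding mem_lcp_sol_iff mult_eq_0_iff idx1_def by force
      have "q - p \<in> lcp_map M ` ?C"
        unfolding lcp_sol_diff_eq[of q p M x2 x]
      proof (rule feasible_direction_in_branch_image[OF cond idx cover])
        show "idx1 M p x \<inter> idx2 M p x = {}" by (auto simp: idx1_def idx2_def)
        show "0 \<le> (x2 - x) $ i" if "i \<notin> idx2 M p x" for i
          using x2 zero[OF that] by (simp add: mem_lcp_sol_iff)
        show "0 \<le> ((M *v x2 + q) - (M *v x + p)) $ i" if "i \<notin> idx1 M p x" for i
          using x2 zero'[OF that] unfolding mem_lcp_sol_iff by simp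
      qed
      then obtain y e where ye: "(y, e) \<in> ?C" "lcp_map M (y, e) = q - p"
        "norm (y, e) \<le> \<kappa> * norm (q - p)"
        using \<kappa>(2) by force
      obtain \<delta> where \<delta>: "\<delta> > 0"
        "\<And>t. 0 \<le> t \<Longrightarrow> t \<le> \<delta> \<Longrightarrow> x + t *\<^sub>R y \<in> lcp_sol M (p + t *\<^sub>R (q - p))"
        using lcp_sol_branch_step[OF xp ye(1)] ye(2) by auto
      \<comment> \<open>The point at fraction \<open>t\<close> from \<open>p\<close> to
        \<open>q\<close> has parameter \<open>s + t * (1 - s)\<close> on the whole segment; the cap
        1 prevents passing \<open>q\<close>.\<close>
      define t where "t = min \<delta> 1"
      have t: "0 < t" "t \<le> 1" "t \<le> \<delta>" using \<delta>(1) by (auto simp: t_def)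
      let ?s = "s + t * (1 - s)"
      have "p + t *\<^sub>R (q - p) = q' + ?s *\<^sub>R (q - q')"
        unfolding qp by (simp add: p_def algebra_simps)
      then have "x + t *\<^sub>R y \<in> lcp_sol M (q' + ?s *\<^sub>R (q - q'))"
        using \<delta>(2)[of t] t by simp
      moreover have "norm (x + t *\<^sub>R y - x) \<le> (?s - s) * (\<kappa> * norm (q - q'))"
      proof -
        have "norm y \<le> \<kappa> * norm (q - p)" using norm_fst_le[of y e] ye(3) by linarith
        also have "\<dots> = (1 - s) * (\<kappa> * norm (q - q'))" unfolding qp using s by simp
        finally have "t * norm y \<le> t * ((1 - s) * (\<kappa> * norm (q - q')))"
          using t(1) by (intro mult_left_mono) auto
        then show ?thesis using t(1) by (simp add: mult.assoc)
      qed
      moreover have "?s > s" using t s by simp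
      moreover have "?s \<le> 1"
      proof -
        have "?s \<le> s + 1 * (1 - s)" using s t(2) by (intro add_left_mono mult_right_mono) auto
        then show ?thesis by simp
      qed
      ultimately show "\<exists>s'>s. s' \<le> 1 \<and> (\<exists>x'\<in>lcp_sol M (q' + s' *\<^sub>R (q - q')).
          norm (x' - x) \<le> (s' - s) * (\<kappa> * norm (q - q')))" by blast
    qed
    then show ?thesis by simp
  qed
  have "lcp_sol M q' \<inter> ball xbar \<eta> \<subseteq>
      {y + (\<kappa> * norm (q' - q)) *\<^sub>R b | y b. y \<in> lcp_sol M q \<and> b \<in> cball 0 1}"
    if "q \<in> ?D \<inter> ball qbar \<eta>" "q' \<in> ?D \<inter> ball qbar \<eta>" for q q'
  proof
    fix x' assume "x' \<in> lcp_sol M q' \<inter> ball xbar \<eta>"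
    then obtain x where x: "x \<in> lcp_sol M q" "norm (x - x') \<le> \<kappa> * norm (q - q')"
      using main[of q q' x'] \<open>q \<in> _\<close> \<open>q' \<in> _\<close> by auto
    define k where "k = \<kappa> * norm (q' - q)"
    have k: "norm (x' - x) \<le> k" using x(2) by (simp add: k_def norm_minus_commute)
    \<comment> \<open>For \<open>k = 0\<close> the points coincide and the quotient is 0 by the
      convention for \<open>inverse 0\<close>.\<close>
    then have "x' = x + k *\<^sub>R ((x' - x) /\<^sub>R k)" by (cases "k = 0") auto
    moreover have "norm ((x' - x) /\<^sub>R k) \<le> 1"
    proof -
      have "0 \<le> k" using k norm_ge_zero order_trans by blast
      then show ?thesis unfolding norm_scaleR using k
        by (cases "k = 0") (simp_all add: field_simps flip: scaleR_diff_right)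
    qed
    ultimately show "x' \<in> {y + (\<kappa> * norm (q' - q)) *\<^sub>R b | y b. y \<in> lcp_sol M q \<and> b \<in> cball 0 1}"
      using x(1) unfolding k_def[symmetric] mem_Collect_eq mem_cball_0 by blast
  qed
  moreover have "locally_closed_at (gph (lcp_sol M)) (qbar, xbar)"
    unfolding locally_closed_at_def using closed_gph_lcp_sol[of M]
    by (intro exI[of _ UNIV]) auto
  ultimately show ?thesis
    unfolding lipschitz_like_relative_def using xbar \<kappa>(1) \<eta>(1)
    by (intro conjI exI[of _ "ball qbar \<eta>"] exI[of _ "ball xbar \<eta>"] exI[of _ \<kappa>])
      (auto simp: domain_of_def)
qed

theorem theorem5p7:
  fixes M :: "real ^ 'n ^ 'n" and qbar xbar :: "real ^ 'n"
  assumes "Q0_matrix M"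
    and "(qbar, xbar) \<in> gph (lcp_sol M)"
  shows "lipschitz_like_relative (lcp_sol M) (domain_of (lcp_sol M)) qbar xbar \<longleftrightarrow>
    (\<forall>u :: real ^ 'n.
       (u, - (transpose M *v u)) \<in> W_cone (idx1 M qbar xbar) (idx2 M qbar xbar) (idx3 M qbar xbar) \<longrightarrow>
       (u, - (transpose M *v u)) \<in> W'_cone (idx1 M qbar xbar) (idx2 M qbar xbar) (idx3 M qbar xbar))"
proof -
  have "xbar \<in> lcp_sol M qbar" using assms(2) by (simp add: gph_def)
  then show ?thesis
    using lipschitz_like_imp_W'_cone[OF assms(1)] W_cone_condition_imp_lipschitz_like by blast
qed

end
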